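(* Let $W(X,t)$ be the discrete quasi-isometric stiffening functional of a simplicial mesh with simplices $T_1,\dots,T_N$ and per-simplex Jacobian matrices $J_i=J_i(X)$, $i=1,\dots,N$, and consider the continuation iteration $X^{k+1}\leftarrow\arg\min_X W(X,t^k)$, all as defined in the context. Suppose that the feasible set of bounded distortion meshes $$\mathcal{A}(t^* )=\{X:\ f(J_i(X))<1/t^*,\ i=1,\dots,N\}$$ is not empty, namely there exist a constant $0<t^*<1$ and a mesh $X^*$ satisfying $W(X^*,t^* )<+\infty$. Suppose also that for solving $X^{k+1}\leftarrow\arg\min_X W(X,t^k)$ we have a minimization algorithm satisfying the following efficiency conditions for some $0<\sigma<1$: for each iteration $k$, - either the essential descent condition holds: $$W(X^{k+1},t^k)\le (1-\sigma)\,W(X^k,t^k),$$ - or the vector $X^k$ satisfies the quasi-minimality condition: $$\min_X W(X,t^k)>(1-\sigma)\,W(X^k,t^k).$$ Then the feasible set $\mathcal{A}(t^* )$ is reachable by solving a finite number of minimization problems in $X$ with $t^k$ fixed for each problem. In other words, under a proper choice of the continuation parameter sequence $\{t^k\}_{k=0}^K$, we obtain $W(X^K,t^K)<+\infty$.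
   Context: Mesh and Jacobians. Let $d\in\{2,3\}$ and fix a finite simplicial mesh of a domain in $\mathbb{R}^d$ (the parametric domain) with $n$ vertices and nondegenerate simplices $T_1,\dots,T_N$; $\mathrm{vol}(T_i)>0$ is the volume of $T_i$ in the parametric domain. A deformed mesh is a vector $X=(\vec x_1^\top,\dots,\vec x_n^\top)^\top$ of vertex positions $\vec x_j\in\mathbb{R}^d$. It defines a continuous map that is affine on each simplex and sends the $j$-th vertex to $\vec x_j$; $J_i=J_i(X)\in\mathbb{R}^{d\times d}$ is the (constant) Jacobian matrix of this map on $T_i$. Distortion. Fix a trade-off parameter $\theta\in[0,1]$. For $J\in\mathbb{R}^{d\times d}$ define $f(J)=(1-\theta)f_s(J)+\theta f_v(J)$, where for $\det J>0$ $$f_s(J)=\frac1d\,\frac{\mathrm{tr}(J^\top J)}{(\det J)^{2/d}},\qquad f_v(J)=\frac12\left(\det J+\frac1{\det J}\right),$$ and $f(J)=+\infty$ if $\det J\le 0$. One has $f(J)\ge 1$. Functional. For $0\le t<1$, $$W(X,t)=\sum_{i=1}^{N}\frac{f(J_i(X))}{1-t\,f(J_i(X))}\,\mathrm{vol}(T_i)$$ if $f(J_i(X))<+\infty$ and $t\,f(J_i(X))<1$ for all $i$, and $W(X,t)=+\infty$ otherwise. Continuation iteration. The iteration starts from an untangled mesh $X^0$, i.e. $\det J_i(X^0)>0$ for all $i$. At iteration $k=0,1,2,\dots$ a parameter $t^k$ is computed, the values $t^k$ forming an increasing sequence, and then the minimization algorithm is applied to the problem of minimizing $W(\cdot,t^k)$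 over $X$, with $t^k$ fixed, starting from $X^k$. Its output, in general only an approximate minimizer, is denoted $X^{k+1}$; this is what $X^{k+1}\leftarrow\arg\min_X W(X,t^k)$ means. *)

theory Defs
  imports "HOL-Analysis.Analysis"
begin

text \<open>
  The vertices are indexed by the finite type \<open>'n\<close>, the simplices by the finite type \<open>'m\<close>.
  The vector of all vertex positions has type \<open>real^'d^'n\<close>, for the parametric mesh \<open>P\<close> as well
  as for a deformed mesh \<open>X\<close>; \<open>T i\<close> is the set of the vertices of the \<open>i\<close>-th simplex.
\<close>

definition cell :: "real^'d^'n \<Rightarrow> ('m \<Rightarrow> 'n set) \<Rightarrow> 'm \<Rightarrow> (real^'d) set" where
  "cell P T i = convex hull ((\<lambda>j. P $ j) ` T i)"

text \<open>
  The condition \<open>triangulation\<close> says that any two cells meet in a common (possibly empty) face.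
\<close>

definition simplicial_mesh :: "(real^'d) set \<Rightarrow> real^'d^'n \<Rightarrow> ('m::finite \<Rightarrow> 'n set) \<Rightarrow> bool" where
  "simplicial_mesh \<Omega> P T \<longleftrightarrow>
     open \<Omega> \<and> connected \<Omega> \<and> closure \<Omega> = (\<Union>i. cell P T i) \<and>
     inj (\<lambda>j. P $ j) \<and> inj T \<and> (\<Union>i. T i) = UNIV \<and>
     (\<forall>i. card (T i) = CARD('d) + 1 \<and> \<not> affine_dependent ((\<lambda>j. P $ j) ` T i)) \<and>
     triangulation (range (cell P T))"

definition deformation_map ::
  "real^'d^'n \<Rightarrow> ('m \<Rightarrow> 'n set) \<Rightarrow> real^'d^'n \<Rightarrow> (real^'d \<Rightarrow> real^'d) \<Rightarrow> bool" where
  "deformation_map P T X \<phi> \<longleftrightarrow>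
     continuous_on (\<Union>i. cell P T i) \<phi> \<and>
     (\<forall>i. \<exists>A c. \<forall>x\<in>cell P T i. \<phi> x = A *v x + c) \<and>
     (\<forall>j. \<phi> (P $ j) = X $ j)"

text \<open>
  For a simplicial mesh, deformation maps agree on all cells, so the matrix below is unique.
\<close>

definition cell_jacobian ::
  "real^'d^'n \<Rightarrow> ('m \<Rightarrow> 'n set) \<Rightarrow> real^'d^'n \<Rightarrow> 'm \<Rightarrow> real^'d^'d" where
  "cell_jacobian P T X i =
     (THE A. \<exists>\<phi>. deformation_map P T X \<phi> \<and>
        (\<forall>x\<in>interior (cell P T i). (\<phi> has_derivative (\<lambda>h. A *v h)) (at x)))"

definition shape_distortion :: "real^'d^'d \<Rightarrow> real" where
  "shape_distortion J =
     1 / real CARD('d) * (trace (transpose J ** J) / det J powr (2 / real CARD('d)))"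

definition volume_distortion :: "real^'d^'d \<Rightarrow> real" where
  "volume_distortion J = 1 / 2 * (det J + 1 / det J)"

definition distortion :: "real \<Rightarrow> real^'d^'d \<Rightarrow> ereal" where
  "distortion \<theta> J =
     (if det J > 0
      then ereal ((1 - \<theta>) * shape_distortion J + \<theta> * volume_distortion J)
      else \<infinity>)"

definition stiffening ::
  "real^'d^'n \<Rightarrow> ('m::finite \<Rightarrow> 'n set) \<Rightarrow> real \<Rightarrow> real^'d^'n \<Rightarrow> real \<Rightarrow> ereal" where
  "stiffening P T \<theta> X t =
     (if \<forall>i. distortion \<theta> (cell_jacobian P T X i) < \<infinity> \<and>
             ereal t * distortion \<theta> (cell_jacobian P T X i) < 1
      then \<Sum>i\<in>UNIV. distortion \<theta> (cell_jacobian P T X i)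
             / (1 - ereal t * distortion \<theta> (cell_jacobian P T X i))
             * ereal (measure lebesgue (cell P T i))
      else \<infinity>)"

definition bounded_distortion_meshes ::
  "real^'d^'n \<Rightarrow> ('m \<Rightarrow> 'n set) \<Rightarrow> real \<Rightarrow> real \<Rightarrow> (real^'d^'n) set" where
  "bounded_distortion_meshes P T \<theta> t =
     {X. \<forall>i. distortion \<theta> (cell_jacobian P T X i) < ereal (1 / t)}"

definition untangled :: "real^'d^'n \<Rightarrow> ('m \<Rightarrow> 'n set) \<Rightarrow> real^'d^'n \<Rightarrow> bool" where
  "untangled P T X \<longleftrightarrow> (\<forall>i. det (cell_jacobian P T X i) > 0)"

text \<open>
  \<open>alg k s Y\<close> is the output of the minimization algorithm when it is applied in iteration \<open>k\<close>
  to the minimization over \<open>X\<close> of the functional with parameter \<open>s\<close>, starting from \<open>Y\<close>.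
  A run with \<open>K\<close> iterations solves \<open>K\<close> minimization problems, with the parameters
  \<open>t 0, \<dots>, t (K - 1)\<close>; the parameter \<open>t K\<close> is the one computed for its final mesh \<open>X K\<close>.
\<close>

definition continuation_run ::
  "(nat \<Rightarrow> real \<Rightarrow> real^'d^'n \<Rightarrow> real^'d^'n) \<Rightarrow> real^'d^'n \<Rightarrow> nat \<Rightarrow>
   (nat \<Rightarrow> real) \<Rightarrow> (nat \<Rightarrow> real^'d^'n) \<Rightarrow> bool" where
  "continuation_run alg X0 K t X \<longleftrightarrow>
     strict_mono_on {..K} t \<and> (\<forall>k\<le>K. 0 \<le> t k \<and> t k < 1) \<and>
     X 0 = X0 \<and> (\<forall>k<K. X (Suc k) = alg k (t k) (X k))"

definition essential_descent ::
  "real^'d^'n \<Rightarrow> ('m::finite \<Rightarrow> 'n set) \<Rightarrow> real \<Rightarrow> real \<Rightarrow> real \<Rightarrow>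
   real^'d^'n \<Rightarrow> real^'d^'n \<Rightarrow> bool" where
  "essential_descent P T \<theta> \<sigma> t X X' \<longleftrightarrow>
     stiffening P T \<theta> X' t \<le> ereal (1 - \<sigma>) * stiffening P T \<theta> X t"

text \<open>
  The infimum is attained at \<open>P\<close>: all Jacobian matrices of \<open>P\<close> are the identity matrix, where
  \<open>distortion\<close> has its minimum 1.
\<close>

definition quasi_minimal ::
  "real^'d^'n \<Rightarrow> ('m::finite \<Rightarrow> 'n set) \<Rightarrow> real \<Rightarrow> real \<Rightarrow> real \<Rightarrow> real^'d^'n \<Rightarrow> bool" where
  "quasi_minimal P T \<theta> \<sigma> t X \<longleftrightarrow>
     (INF Y. stiffening P T \<theta> Y t) > ereal (1 - \<sigma>) * stiffening P T \<theta> X t"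

end

theory Submission
  imports Defs
begin

text \<open>
  The parameters are chosen so that all the values \<open>W(X\<^sup>k, t\<^sup>k)\<close> equal one large constant \<open>C\<close>, with
  \<open>(1 - \<sigma>) C \<ge> W(X\<^sup>*, t\<^sup>*)\<close>. As long as \<open>t\<^sup>k < t\<^sup>*\<close>, the mesh \<open>X\<^sup>k\<close> is then not quasi-minimal, so
  the essential descent condition holds and \<open>W(X\<^sup>k\<^sup>+\<^sup>1, t\<^sup>k) \<le> (1 - \<sigma>) C\<close>. If \<open>X\<^sup>k\<^sup>+\<^sup>1\<close> is not yet in the
  feasible set, then \<open>W(X\<^sup>k\<^sup>+\<^sup>1, t)\<close> blows up at some \<open>t \<le> t\<^sup>*\<close>, and the intermediate
  value theorem gives the next parameter.
  Since the \<open>t\<close>-derivative of \<open>W\<close> is at most \<open>W\<^sup>2 / min\<^sub>i vol(T\<^sub>i)\<close>, the parameter grows by at least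
  \<open>\<sigma> min\<^sub>i vol(T\<^sub>i) / C\<close> in each iteration, so \<open>t\<^sup>*\<close> is passed after finitely many of them.
\<close>

section \<open>The functional of one fixed mesh as a real function of the parameter\<close>

definition stiffening_sum :: "('m::finite \<Rightarrow> real) \<Rightarrow> ('m \<Rightarrow> real) \<Rightarrow> real \<Rightarrow> real" where
  "stiffening_sum f v t = (\<Sum>i\<in>UNIV. f i / (1 - t * f i) * v i)"

lemma stiffening_sum_mono:
  assumes f: "\<And>i. 0 \<le> f i" and v: "\<And>i. 0 \<le> v i"
    and "s \<le> t" and t: "\<And>i. t * f i < 1"
  shows "stiffening_sum f v s \<le> stiffening_sum f v t"
  unfolding stiffening_sum_def
proof (rule sum_mono)
  fix i
  have "s * f i \<le> t * f i"
    using \<open>s \<le> t\<close> f[of i] by (rule mult_right_mono)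
  then have "f i / (1 - s * f i) \<le> f i / (1 - t * f i)"
    using t[of i] f[of i] by (intro divide_left_mono mult_pos_pos) auto
  then show "f i / (1 - s * f i) * v i \<le> f i / (1 - t * f i) * v i"
    using v[of i] by (rule mult_right_mono)
qed

text \<open>This is the derivative bound in finite-difference form: with
  \<open>g r i = f i / (1 - r * f i)\<close>, the difference \<open>g t i - g s i\<close> is exactly
  \<open>(t - s) * (g t i * g s i)\<close>. One factor is at most \<open>C / m\<close>, because a
  single summand is at most the whole sum, and the other factors sum to at most
  \<open>C\<close>.\<close>

lemma stiffening_sum_increment:
  assumes f: "\<And>i. 0 \<le> f i" and v: "\<And>i. m \<le> v i" and "0 < m"
    and "s \<le> t" and t: "\<And>i. t * f i < 1" and C: "stiffening_sum f v t \<le> C"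
  shows "stiffening_sum f v t - stiffening_sum f v s \<le> (t - s) * (C\<^sup>2 / m)"
proof -
  define g where "g r i = f i / (1 - r * f i)" for r i
  have v0: "0 < v i" for i
    using v[of i] \<open>0 < m\<close> by linarith
  have s: "s * f i < 1" for i
    using mult_right_mono[OF \<open>s \<le> t\<close> f[of i]] t[of i] by linarith
  have g0: "0 \<le> g t i" "0 \<le> g s i" for i
    using f[of i] t[of i] s[of i] by (auto simp: g_def)
  have sum_eq: "stiffening_sum f v r = (\<Sum>i\<in>UNIV. g r i * v i)" for r
    by (simp add: stiffening_sum_def g_def)
  have s_le: "stiffening_sum f v s \<le> C"
    using stiffening_sum_mono[of f v s t] f v0 \<open>s \<le> t\<close> t C by (force intro: less_imp_le)
  have "0 \<le> C"
    using s_le g0 v0 unfolding sum_eq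
    by (meson order_trans sum_nonneg mult_nonneg_nonneg less_imp_le)
  have gC: "g t i \<le> C / m" for i
  proof -
    have "g t i * m \<le> g t i * v i"
      using g0 v by (simp add: mult_left_mono)
    also have "\<dots> \<le> stiffening_sum f v t"
      unfolding sum_eq using g0 less_imp_le[OF v0] by (intro member_le_sum) auto
    finally show ?thesis
      using C \<open>0 < m\<close> by (simp add: field_simps)
  qed
  have diff: "g t i - g s i = (t - s) * (g t i * g s i)" for i
    using t[of i] s[of i] by (simp add: g_def divide_simps) (simp add: algebra_simps)
  have "stiffening_sum f v t - stiffening_sum f v s = (t - s) * (\<Sum>i\<in>UNIV. g t i * (g s i * v i))"
    by (simp add: sum_eq sum_subtractf[symmetric] left_diff_distrib[symmetric] diff
        sum_distrib_left mult.assoc)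
  also have "(\<Sum>i\<in>UNIV. g t i * (g s i * v i)) \<le> (\<Sum>i\<in>UNIV. C / m * (g s i * v i))"
    using gC g0 v0 by (intro sum_mono mult_right_mono mult_nonneg_nonneg) (auto intro: less_imp_le)
  also have "\<dots> = C / m * stiffening_sum f v s"
    by (simp add: sum_eq sum_distrib_left)
  also have "\<dots> \<le> C / m * C"
    using s_le \<open>0 \<le> C\<close> \<open>0 < m\<close> by (intro mult_left_mono) auto
  finally show ?thesis
    using \<open>s \<le> t\<close> by (simp add: mult_left_mono power2_eq_square)
qed

text \<open>The sum blows up at \<open>1 / M\<close>, where \<open>M\<close> is the largest
  \<open>f i\<close>, and \<open>1 / M\<close> is at most \<open>u\<close> because some
  \<open>u * f i\<close> is at least 1. Below \<open>1 / M\<close> the sum is continuous, so it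
  takes the value \<open>C\<close> on the way.\<close>

lemma stiffening_sum_attains:
  assumes f: "\<And>i. 0 \<le> f i" and v: "\<And>i. 0 < v i"
    and "0 \<le> s" and s: "\<And>i. s * f i < 1"
    and C: "stiffening_sum f v s \<le> C" "0 < C"
    and u: "0 < u" "\<not> (\<forall>i. u * f i < 1)"
  shows "\<exists>t. s \<le> t \<and> t < u \<and> (\<forall>i. t * f i < 1) \<and> stiffening_sum f v t = C"
proof -
  define M where "M = Max (range f)"
  have fM: "f i \<le> M" for i
    by (simp add: M_def)
  have "M \<in> range f"
    unfolding M_def by (rule Max_in) auto
  then obtain j where j: "M = f j"
    by blast
  obtain i where "1 \<le> u * f i"
    using u(2) by (auto simp: not_less)
  also have "u * f i \<le> u * M"
    using fM u(1) by simp
  finally have uM: "1 \<le> u * M" .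
  with u(1) have "0 < M"
    by (metis mult_nonneg_nonpos not_le not_one_le_zero less_imp_le order_trans)
  have below: "t * f i < 1" if "0 \<le> t" "t < 1 / M" for t i
  proof -
    have "t * f i \<le> t * M"
      using fM that by (simp add: mult_left_mono)
    then show ?thesis
      using that \<open>0 < M\<close> by (simp add: field_simps)
  qed
  have sM: "s < 1 / M"
    using s[of j] \<open>0 < M\<close> by (simp add: j field_simps)
  \<comment> \<open>The summand of a maximal \<open>f j\<close> equals
    \<open>v j / (1 / M - r)\<close>. It reaches \<open>C\<close> once \<open>1 / M - r\<close> is
    at most \<open>v j / C\<close>; the other entry of the minimum keeps \<open>r\<close> at or
    above \<open>s\<close>.\<close>
  define r where "r = 1 / M - min (1 / M - s) (v j / C)"
  have r: "s \<le> r" "r < 1 / M" "1 / M - r \<le> v j / C"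
    using sM v[of j] C(2) by (auto simp: r_def)
  then have r1: "r * f i < 1" for i
    using below \<open>0 \<le> s\<close> by auto
  have "C \<le> v j / (1 / M - r)"
    using r C(2) v[of j] by (simp add: field_simps)
  also have "\<dots> = f j / (1 - r * f j) * v j"
    using \<open>0 < M\<close> r by (simp add: j[symmetric] field_simps)
  also have "\<dots> \<le> stiffening_sum f v r"
    unfolding stiffening_sum_def using f v r1
    by (intro member_le_sum) (auto intro!: mult_nonneg_nonneg divide_nonneg_pos intro: less_imp_le)
  finally have "C \<le> stiffening_sum f v r" .
  moreover have "continuous_on {s..r} (stiffening_sum f v)"
  proof -
    have "1 - t * f i \<noteq> 0" if "t \<in> {s..r}" for t i
      using below[of t i] that r \<open>0 \<le> s\<close> by auto
    then show ?thesis
      unfolding stiffening_sum_def by (intro continuous_intros) auto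
  qed
  ultimately obtain t where t: "s \<le> t" "t \<le> r" "stiffening_sum f v t = C"
    using IVT'[of "stiffening_sum f v" s C r] C(1) r(1) by auto
  have "1 / M \<le> u"
    using uM \<open>0 < M\<close> by (simp add: field_simps)
  then show ?thesis
    using t r below[of t] \<open>0 \<le> s\<close> by (intro exI[of _ t]) auto
qed

section \<open>Distortions and cell volumes as real numbers\<close>

definition finite_distortion :: "real \<Rightarrow> real^'d^'d \<Rightarrow> real" where
  "finite_distortion \<theta> J = (1 - \<theta>) * shape_distortion J + \<theta> * volume_distortion J"

lemma finite_distortion_nonneg:
  assumes "0 \<le> \<theta>" "\<theta> \<le> 1" "det J > 0"
  shows "0 \<le> finite_distortion \<theta> J"
proof -
  have "0 \<le> trace (transpose J ** J)"
    by (auto simp: trace_def matrix_matrix_mult_def transpose_def intro!: sum_nonneg)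
  then show ?thesis
    using assms unfolding finite_distortion_def shape_distortion_def volume_distortion_def
    by (intro add_nonneg_nonneg mult_nonneg_nonneg) auto
qed

lemma distortion_less_iff: "distortion \<theta> J < ereal c \<longleftrightarrow> det J > 0 \<and> finite_distortion \<theta> J < c"
  by (simp add: distortion_def finite_distortion_def)

lemma stiffening_eq:
  "stiffening P T \<theta> X t =
     (if untangled P T X \<and> (\<forall>i. t * finite_distortion \<theta> (cell_jacobian P T X i) < 1)
      then ereal (stiffening_sum (\<lambda>i. finite_distortion \<theta> (cell_jacobian P T X i))
             (\<lambda>i. measure lebesgue (cell P T i)) t)
      else \<infinity>)"
proof (cases "untangled P T X")
  case True
  then have *: "distortion \<theta> (cell_jacobian P T X i)
      = ereal (finite_distortion \<theta> (cell_jacobian P T X i))" for i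
    by (simp add: untangled_def distortion_def finite_distortion_def)
  \<comment> \<open>The condition keeps the denominator positive; at zero, division in
    \<open>ereal\<close> and in \<open>real\<close> would differ.\<close>
  have "ereal x / (1 - ereal t * ereal x) * ereal v = ereal (x / (1 - t * x) * v)"
    if "t * x < 1" for x v
    using that by (simp add: one_ereal_def)
  then show ?thesis
    using True by (simp add: stiffening_def * stiffening_sum_def del: times_ereal.simps)
      (simp add: one_ereal_def)
next
  case False
  then show ?thesis
    by (auto simp: stiffening_def untangled_def distortion_def)
qed

text \<open>The hull of d + 1 affinely independent points in dimension d has nonempty interior, so
  it is not negligible.\<close>

lemma simplicial_mesh_measure_pos:
  fixes P :: "real^'d^'n" and T :: "'m::finite \<Rightarrow> 'n set"
  assumes "simplicial_mesh \<Omega> P T"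
  shows "0 < measure lebesgue (cell P T i)"
proof -
  let ?S = "(\<lambda>j. P $ j) ` T i"
  have "inj_on (\<lambda>j. P $ j) (T i)" "card (T i) = CARD('d) + 1" "\<not> affine_dependent ?S"
    using assms by (auto simp: simplicial_mesh_def intro: inj_on_subset)
  then have "interior (convex hull ?S) \<noteq> {}"
    by (subst interior_convex_hull_eq_empty) (auto simp: card_image)
  then have "\<not> negligible (cell P T i)"
    by (simp add: cell_def negligible_convex_interior)
  moreover have "cell P T i \<in> lmeasurable"
    unfolding cell_def
    by (intro lmeasurable_compact compact_convex_hull finite_imp_compact) simp
  ultimately show ?thesis
    by (simp add: negligible_iff_measure less_le)
qed

section \<open>Steering the continuation run\<close>

lemma continuation_run_Suc:
  assumes run: "continuation_run alg X0 k t X" and "t k < s" "s < 1"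
  shows "continuation_run alg X0 (Suc k) (t(Suc k := s)) (X(Suc k := alg k (t k) (X k)))"
proof -
  have mono: "strict_mono_on {..k} t" and range: "\<And>j. j \<le> k \<Longrightarrow> 0 \<le> t j \<and> t j < 1"
    using run by (auto simp: continuation_run_def)
  have "t j < s" if "j \<le> k" for j
    using that strict_mono_onD[OF mono, of j k] \<open>t k < s\<close> by (cases "j = k") auto
  then have "strict_mono_on {..Suc k} (t(Suc k := s))"
    using strict_mono_onD[OF mono] by (auto intro!: strict_mono_onI simp: le_Suc_eq)
  moreover have "0 \<le> s"
    using range[of k] \<open>t k < s\<close> by auto
  ultimately show ?thesis
    using run \<open>s < 1\<close> by (auto simp: continuation_run_def le_Suc_eq less_Suc_eq)
qed

theorem theorem2:
  fixes \<Omega> :: "(real^'d) set"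
    and P X0 Xstar :: "real^'d^'n"
    and T :: "'m::finite \<Rightarrow> 'n set"
    and \<theta> \<sigma> tstar :: real
    and alg :: "nat \<Rightarrow> real \<Rightarrow> real^'d^'n \<Rightarrow> real^'d^'n"
  assumes dim: "CARD('d) = 2 \<or> CARD('d) = 3"
    and mesh: "simplicial_mesh \<Omega> P T"
    and theta: "0 \<le> \<theta>" "\<theta> \<le> 1"
    and X0: "untangled P T X0"
    and tstar: "0 < tstar" "tstar < 1"
    and nonempty: "bounded_distortion_meshes P T \<theta> tstar \<noteq> {}"
    and Xstar: "stiffening P T \<theta> Xstar tstar < \<infinity>"
    and sigma: "0 < \<sigma>" "\<sigma> < 1"
    and efficient: "\<And>K t X k. continuation_run alg X0 K t X \<Longrightarrow> k < K \<Longrightarrow>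
      essential_descent P T \<theta> \<sigma> (t k) (X k) (X (Suc k)) \<or> quasi_minimal P T \<theta> \<sigma> (t k) (X k)"
  shows "\<exists>K t X. continuation_run alg X0 K t X \<and>
    tstar \<le> t K \<and> stiffening P T \<theta> (X K) (t K) < \<infinity> \<and>
    X K \<in> bounded_distortion_meshes P T \<theta> tstar"
proof -
  define f where "f X i = finite_distortion \<theta> (cell_jacobian P T X i)" for X i
  define v where "v i = measure lebesgue (cell P T i)" for i
  define W where "W X = stiffening_sum (f X) v" for X
  define \<A> where "\<A> t = {X. untangled P T X \<and> (\<forall>i. t * f X i < 1)}" for t
  define reached where "reached \<longleftrightarrow> (\<exists>K t X. continuation_run alg X0 K t X \<and>
    tstar \<le> t K \<and> stiffening P T \<theta> (X K) (t K) < \<infinity> \<and>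
    X K \<in> bounded_distortion_meshes P T \<theta> tstar)"
  have stiff: "stiffening P T \<theta> X t = (if X \<in> \<A> t then ereal (W X t) else \<infinity>)" for X t
    by (simp add: stiffening_eq \<A>_def W_def f_def[abs_def] v_def[abs_def])
  have f0: "0 \<le> f X i" if "untangled P T X" for X i
    using that theta finite_distortion_nonneg by (auto simp: f_def untangled_def)
  have v0: "0 < v i" for i
    using simplicial_mesh_measure_pos[OF mesh] by (simp add: v_def)
  define m where "m = Min (range v)"
  have m: "0 < m" "m \<le> v i" for i
    using v0 by (auto simp: m_def)
  have Xs: "Xstar \<in> \<A> tstar"
    using Xstar by (auto simp: stiff split: if_splits)
  \<comment> \<open>The entry 1 makes \<open>C\<close> positive, \<open>W X0 0\<close> lets the
    first parameter be sought upwards from 0, and the last entry makes \<open>Xstar\<close> a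
    competitor that refutes quasi-minimality.\<close>
  define C where "C = Max {1, W X0 0, W Xstar tstar / (1 - \<sigma>)}"
  have C: "0 < C" "W X0 0 \<le> C" "W Xstar tstar \<le> (1 - \<sigma>) * C"
  proof -
    have le: "1 \<le> C" "W X0 0 \<le> C" "W Xstar tstar / (1 - \<sigma>) \<le> C"
      by (auto simp: C_def)
    then show "0 < C" "W X0 0 \<le> C"
      by auto
    show "W Xstar tstar \<le> (1 - \<sigma>) * C"
      using le(3) sigma by (simp add: field_simps)
  qed
  \<comment> \<open>The smallest parameter gain that can make up a descent of
    \<open>\<sigma> * C\<close> when \<open>W\<close> grows at rate at most
    \<open>C\<^sup>2 / m\<close>.\<close>
  define \<delta> where "\<delta> = \<sigma> * m / C"
  have "0 < \<delta>"
    using sigma m C by (simp add: \<delta>_def)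
  have finish: reached if "continuation_run alg X0 K t X" "t K = tstar" "X K \<in> \<A> tstar" for K t X
  proof -
    have "X K \<in> bounded_distortion_meshes P T \<theta> tstar"
      using that(3) tstar
      by (auto simp: bounded_distortion_meshes_def distortion_less_iff \<A>_def untangled_def f_def
          field_simps)
    then show ?thesis
      unfolding reached_def using that by (intro exI[of _ K] exI[of _ t] exI[of _ X]) (simp add: stiff)
  qed
  \<comment> \<open>\<open>W Xstar s\<close> is at most \<open>W Xstar tstar\<close>, hence at most
    \<open>(1 - \<sigma>) * W Y s\<close>, and it bounds the infimum from above.\<close>
  have not_quasi_minimal: "\<not> quasi_minimal P T \<theta> \<sigma> s Y"
    if "Y \<in> \<A> s" "W Y s = C" "s \<le> tstar" for s Y
  proof -
    have unt: "untangled P T Xstar" and star: "\<And>i. tstar * f Xstar i < 1"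
      using Xs by (auto simp: \<A>_def)
    have "s * f Xstar i < 1" for i
      using mult_right_mono[OF \<open>s \<le> tstar\<close> f0[OF unt, of i]] star[of i] by linarith
    then have "stiffening P T \<theta> Xstar s = ereal (W Xstar s)"
      using unt by (simp add: stiff \<A>_def)
    moreover have "W Xstar s \<le> W Xstar tstar"
      unfolding W_def using f0[OF unt] v0 \<open>s \<le> tstar\<close> star
      by (intro stiffening_sum_mono) (auto intro: less_imp_le)
    ultimately have "stiffening P T \<theta> Xstar s \<le> ereal ((1 - \<sigma>) * C)"
      using C(3) by auto
    then have "(INF Y. stiffening P T \<theta> Y s) \<le> ereal ((1 - \<sigma>) * C)"
      by (meson INF_lower UNIV_I order_trans)
    then show ?thesis
      using that by (simp add: quasi_minimal_def stiff not_less)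
  qed
  have progress: "reached \<or> (\<exists>t X. continuation_run alg X0 k t X \<and> X k \<in> \<A> (t k) \<and>
      W (X k) (t k) = C \<and> t k < tstar \<and> real k * \<delta> \<le> t k)" for k
  proof (induction k)
    case 0
    have run: "continuation_run alg X0 0 (\<lambda>_. s) (\<lambda>_. X0)" if "0 \<le> s" "s < 1" for s
      using that by (auto simp: continuation_run_def strict_mono_on_def)
    show ?case
    proof (cases "\<forall>i. tstar * f X0 i < 1")
      case True
      then have reached
        using finish[OF run] X0 tstar by (simp add: \<A>_def)
      then show ?thesis ..
    next
      case False
      obtain s where s: "0 \<le> s" "s < tstar" "\<forall>i. s * f X0 i < 1" "W X0 s = C"
        using stiffening_sum_attains[of "f X0" v 0 C tstar] f0[OF X0] v0 C tstar False
        by (auto simp: W_def)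
      then show ?thesis
        using run[of s] X0 tstar
        by (intro disjI2 exI[of _ "\<lambda>_. s"] exI[of _ "\<lambda>_. X0"]) (auto simp: \<A>_def)
    qed
  next
    case (Suc k)
    then consider reached | t X where "continuation_run alg X0 k t X" "X k \<in> \<A> (t k)"
      "W (X k) (t k) = C" "t k < tstar" "real k * \<delta> \<le> t k"
      by blast
    then show ?case
    proof cases
      case 1
      then show ?thesis ..
    next
      case (2 t X)
      \<comment> \<open>The output \<open>Y\<close> depends on \<open>t k\<close> but not on the
        next parameter, which may therefore be chosen after \<open>Y\<close> is known.\<close>
      define Y where "Y = alg k (t k) (X k)"
      have run: "continuation_run alg X0 (Suc k) (t(Suc k := s)) (X(Suc k := Y))"
        if "t k < s" "s < 1" for s
        unfolding Y_def using 2(1) that by (rule continuation_run_Suc)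
      have "0 \<le> t k"
        using 2(1) by (auto simp: continuation_run_def)
      \<comment> \<open>The efficiency conditions at \<open>k\<close> concern runs longer than
        \<open>k\<close>, so the run is extended provisionally with \<open>tstar\<close> as next
        parameter.\<close>
      have "essential_descent P T \<theta> \<sigma> (t k) (X k) Y"
        using efficient[OF run[of tstar], of k] not_quasi_minimal[of "X k" "t k"] 2 tstar by auto
      then have "stiffening P T \<theta> Y (t k) \<le> ereal ((1 - \<sigma>) * C)"
        using 2 by (simp add: essential_descent_def stiff)
      then have YA: "Y \<in> \<A> (t k)" and YC: "W Y (t k) \<le> (1 - \<sigma>) * C"
        by (auto simp: stiff split: if_splits)
      then have unt: "untangled P T Y" and Y1: "\<And>i. t k * f Y i < 1"
        by (auto simp: \<A>_def)
      show ?thesis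
      proof (cases "\<forall>i. tstar * f Y i < 1")
        case True
        then have reached
          using finish[OF run[of tstar]] unt 2(4) tstar by (simp add: \<A>_def)
        then show ?thesis ..
      next
        case False
        have "(1 - \<sigma>) * C \<le> C"
          using sigma C(1) by simp
        with YC have "W Y (t k) \<le> C"
          by linarith
        then obtain s where s: "t k \<le> s" "s < tstar" "\<forall>i. s * f Y i < 1" "W Y s = C"
          using stiffening_sum_attains[of "f Y" v "t k" C tstar] f0[OF unt] v0 \<open>0 \<le> t k\<close> Y1
            C(1) tstar(1) False
          by (auto simp: W_def)
        have "\<sigma> * C \<le> W Y s - W Y (t k)"
          using s(4) YC by (simp add: algebra_simps)
        also have "\<dots> \<le> (s - t k) * (C\<^sup>2 / m)"
          unfolding W_def using f0[OF unt] m s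
          by (intro stiffening_sum_increment) (auto simp: W_def)
        finally have "C * (\<sigma> * m) \<le> C * ((s - t k) * C)"
          using m(1) by (simp add: field_simps power2_eq_square)
        then have "\<delta> \<le> s - t k"
          \<comment> \<open>The positive gap also provides the strict increase that a run
            demands.\<close>
          using C(1) by (simp only: mult_le_cancel_left_pos) (simp add: \<delta>_def pos_divide_le_eq)
        with \<open>0 < \<delta>\<close> 2(5) have "t k < s" "real (Suc k) * \<delta> \<le> s"
          by (auto simp: algebra_simps)
        moreover from this(1) have "continuation_run alg X0 (Suc k) (t(Suc k := s)) (X(Suc k := Y))"
          using s(2) tstar(2) by (intro run) auto
        moreover have "Y \<in> \<A> s"
          using s(3) unt by (simp add: \<A>_def)
        ultimately show ?thesis
          using s by (intro disjI2 exI[of _ "t(Suc k := s)"] exI[of _ "X(Suc k := Y)"] conjI)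
            (assumption | simp)+
      qed
    qed
  qed
  \<comment> \<open>For this \<open>k\<close> the second alternative of \<open>progress\<close>
    would give \<open>tstar < t k < tstar\<close>.\<close>
  obtain k where "tstar < real k * \<delta>"
    using reals_Archimedean3[OF \<open>0 < \<delta>\<close>] by blast
  with progress[of k] have reached
    by auto
  then show ?thesis
    unfolding reached_def .
qed

end
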